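(* Let $X$ be a nonempty set, let $i,j\in\{1,2,3,4\}$, let $F\colon X^2\to X$ be an operation, and let $G\colon X^2\to X$ be defined by $G(x,y)=F(y,x)$ for all $x,y\in X$. Then $F$ is $(i,j)$-selective if and only if $G$ is $(5-j,5-i)$-selective. Likewise, $F$ is transitive if and only if $G$ is dual transitive.
   Context: For $i,j\in\{1,2,3,4\}$, an operation $F\colon X^2\to X$ is $(i,j)$-selective if $F(F(x_1,x_2),F(x_3,x_4))=F(x_i,x_j)$ for all $x_1,x_2,x_3,x_4\in X$. An operation $F\colon X^2\to X$ is transitive if $F(F(x,z),F(y,z))=F(x,y)$ for all $x,y,z\in X$, and dual transitive if $F(F(x,y),F(x,z))=F(y,z)$ for all $x,y,z\in X$. *)

theory Defs
  imports "HOL-Library.FuncSet"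
begin

text \<open>An operation on a carrier \<open>X\<close> is a curried function in \<open>X \<rightarrow> X \<rightarrow> X\<close>;
  its values outside \<open>X\<close> are irrelevant below.\<close>

text \<open>A quadruple \<open>(x\<^sub>1, x\<^sub>2, x\<^sub>3, x\<^sub>4)\<close> of elements of \<open>X\<close> is a function on the
  indices \<open>{1..4}\<close>, so that the indices \<open>i\<close> and \<open>j\<close> can be variables; the notion is meant
  for \<open>i, j \<in> {1..4}\<close> only.\<close>

definition selective_on :: "'a set \<Rightarrow> nat \<Rightarrow> nat \<Rightarrow> ('a \<Rightarrow> 'a \<Rightarrow> 'a) \<Rightarrow> bool" where
  "selective_on X i j F \<longleftrightarrow>
     (\<forall>x \<in> {1..4} \<rightarrow> X. F (F (x 1) (x 2)) (F (x 3) (x 4)) = F (x i) (x j))"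

definition transitive_on :: "'a set \<Rightarrow> ('a \<Rightarrow> 'a \<Rightarrow> 'a) \<Rightarrow> bool" where
  "transitive_on X F \<longleftrightarrow> (\<forall>x\<in>X. \<forall>y\<in>X. \<forall>z\<in>X. F (F x z) (F y z) = F x y)"

definition dual_transitive_on :: "'a set \<Rightarrow> ('a \<Rightarrow> 'a \<Rightarrow> 'a) \<Rightarrow> bool" where
  "dual_transitive_on X F \<longleftrightarrow> (\<forall>x\<in>X. \<forall>y\<in>X. \<forall>z\<in>X. F (F x y) (F x z) = F y z)"

end

theory Submission
  imports Defs
begin

text \<open>Passing from \<open>F\<close> to \<open>G\<close> reads every expression backwards:
  \<open>G (G a b) (G c d) = F (F d c) (F b a)\<close>. Hence the identity for \<open>G\<close> at a
  quadruple is the one for \<open>F\<close> at the reversed quadruple, where index \<open>k\<close>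
  becomes \<open>5 - k\<close> and the pair (i, j) also changes order. One implication suffices,
  since both reversals are involutions; this is \<open>selective_on_swap\<close>. The same reversal
  exchanges the two transitivity laws.\<close>

lemma selective_on_swap:
  fixes F G :: "'a \<Rightarrow> 'a \<Rightarrow> 'a"
  assumes sel: "selective_on X i j F" and "i \<in> {1..4}" "j \<in> {1..4}"
    and F: "F \<in> X \<rightarrow> X \<rightarrow> X"
    and G: "\<And>x y. x \<in> X \<Longrightarrow> y \<in> X \<Longrightarrow> G x y = F y x"
  shows "selective_on X (5 - j) (5 - i) G"
  unfolding selective_on_def
proof
  fix x :: "nat \<Rightarrow> 'a" assume x: "x \<in> {1..4} \<rightarrow> X"
  have X: "x k \<in> X" if "k \<in> {1..4}" for k using x that by blast
  have FX: "F a b \<in> X" if "a \<in> X" "b \<in> X" for a b using F that by blast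
  have "G (G (x 1) (x 2)) (G (x 3) (x 4)) = F (F (x 4) (x 3)) (F (x 2) (x 1))"
    by (simp add: G X FX)
  also have "\<dots> = F (x (5 - i)) (x (5 - j))"
  proof -
    \<comment> \<open>The reversed quadruple; k and \<open>5 - k\<close> both range over
      \<open>{1..4}\<close>.\<close>
    have "(\<lambda>k. x (5 - k)) \<in> {1..4} \<rightarrow> X" by (intro Pi_I X) auto
    from sel[unfolded selective_on_def, rule_format, OF this] show ?thesis by simp
  qed
  also have "\<dots> = G (x (5 - j)) (x (5 - i))"
    using assms(2,3) by (intro G[symmetric] X) auto
  finally show "G (G (x 1) (x 2)) (G (x 3) (x 4)) = G (x (5 - j)) (x (5 - i))" .
qed

theorem lemma2p8:
  fixes X :: "'a set" and F G :: "'a \<Rightarrow> 'a \<Rightarrow> 'a" and i j :: nat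
  assumes "X \<noteq> {}"
    and "i \<in> {1..4}" and "j \<in> {1..4}"
    and "F \<in> X \<rightarrow> X \<rightarrow> X"
    and "\<And>x y. x \<in> X \<Longrightarrow> y \<in> X \<Longrightarrow> G x y = F y x"
  shows "(selective_on X i j F \<longleftrightarrow> selective_on X (5 - j) (5 - i) G) \<and>
         (transitive_on X F \<longleftrightarrow> dual_transitive_on X G)"
proof
  have FX: "F a b \<in> X" if "a \<in> X" "b \<in> X" for a b using assms(4) that by blast
  have GX: "G \<in> X \<rightarrow> X \<rightarrow> X" using assms(5) FX by (simp add: Pi_iff)
  show "selective_on X i j F \<longleftrightarrow> selective_on X (5 - j) (5 - i) G"
  proof
    assume "selective_on X (5 - j) (5 - i) G"
    \<comment> \<open>The roles of \<open>F\<close> and \<open>G\<close> are exchanged; truncated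
      subtraction does no harm, as i and j are at most 4.\<close>
    then have "selective_on X (5 - (5 - i)) (5 - (5 - j)) F"
      by (rule selective_on_swap) (use assms GX in auto)
    then show "selective_on X i j F" using assms(2,3) by simp
  qed (rule selective_on_swap[OF _ assms(2-5)])
  show "transitive_on X F \<longleftrightarrow> dual_transitive_on X G"
    unfolding transitive_on_def dual_transitive_on_def
    \<comment> \<open>With every \<open>G\<close> rewritten through \<open>F\<close>, the two laws
      differ only by exchanging the variables x and z; \<open>ball_cong\<close> supplies the
      memberships that the rewriting needs.\<close>
    using assms(5) FX by (simp cong: ball_cong) blast
qed

end
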